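(* For any integer $r\geq 3$ there exists a constant $c_r>0$ (depending only on $r$) such that the following holds: for any $n$ and any $t=t(n)\geq\binom{r}{2}$, \[\operatorname{sat}_t(n,\mathfrak{R}(K_r))\leq \max\left\{\frac{c_r}{\log t}\,n\log n,\ 2(r-2)n\right\}.\]
   Context: A $t$-edge-coloured graph is a graph $G$ with a function $c:E(G)\to\{1,\dots,t\}$ (not necessarily proper). A copy of $H$ is rainbow if all its edges receive distinct colours; $\mathfrak{R}(H)$ denotes the family of rainbow copies of $H$. A $t$-edge-coloured graph is $\mathfrak{R}(H)$-saturated if it contains no rainbow copy of $H$ but adding any non-edge in any colour from $\{1,\dots,t\}$ creates a rainbow copy of $H$. $\operatorname{sat}_t(n,\mathfrak{R}(H))$ is the minimum number of edges of such a graph on $n$ vertices. Logarithms are base 2. *)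

theory Defs
  imports Complex_Main
begin

record 'a ugraph =
  verts :: "'a set"
  edges :: "'a set set"

definition all_edges :: "'a set \<Rightarrow> 'a set set" where
  "all_edges V = {e. e \<subseteq> V \<and> card e = 2}"

definition simple_graph :: "'a ugraph \<Rightarrow> bool" where
  "simple_graph G \<longleftrightarrow> finite (verts G) \<and> edges G \<subseteq> all_edges (verts G)"

definition complete_graph :: "nat \<Rightarrow> nat ugraph" where
  "complete_graph r = \<lparr>verts = {..<r}, edges = all_edges {..<r}\<rparr>"

definition subgraph_of :: "'a ugraph \<Rightarrow> 'a ugraph \<Rightarrow> bool" where
  "subgraph_of G' G \<longleftrightarrow> simple_graph G' \<and> verts G' \<subseteq> verts G \<and> edges G' \<subseteq> edges G"

definition isomorphic_graphs :: "'b ugraph \<Rightarrow> 'a ugraph \<Rightarrow> bool" where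
  "isomorphic_graphs H G \<longleftrightarrow>
     (\<exists>f. bij_betw f (verts H) (verts G) \<and> edges G = (\<lambda>e. f ` e) ` edges H)"

text \<open>Only the values of a colouring on the edges of the graph matter; elsewhere it is arbitrary.\<close>

definition edge_coloured_graph :: "nat \<Rightarrow> 'a ugraph \<Rightarrow> ('a set \<Rightarrow> nat) \<Rightarrow> bool" where
  "edge_coloured_graph t G c \<longleftrightarrow> simple_graph G \<and> (\<forall>e\<in>edges G. c e \<in> {1..t})"

definition has_rainbow_copy :: "'b ugraph \<Rightarrow> 'a ugraph \<Rightarrow> ('a set \<Rightarrow> nat) \<Rightarrow> bool" where
  "has_rainbow_copy H G c \<longleftrightarrow>
     (\<exists>H'. subgraph_of H' G \<and> isomorphic_graphs H H' \<and> inj_on c (edges H'))"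

definition add_edge :: "'a set \<Rightarrow> 'a ugraph \<Rightarrow> 'a ugraph" where
  "add_edge e G = G\<lparr>edges := insert e (edges G)\<rparr>"

definition rainbow_saturated ::
  "nat \<Rightarrow> 'b ugraph \<Rightarrow> 'a ugraph \<Rightarrow> ('a set \<Rightarrow> nat) \<Rightarrow> bool" where
  "rainbow_saturated t H G c \<longleftrightarrow>
     edge_coloured_graph t G c \<and>
     \<not> has_rainbow_copy H G c \<and>
     (\<forall>e \<in> all_edges (verts G) - edges G. \<forall>i \<in> {1..t}.
        has_rainbow_copy H (add_edge e G) (c(e := i)))"

text \<open>Every finite graph is isomorphic to one whose vertices are natural numbers, so it
  suffices to let the graphs range over \<^typ>\<open>nat ugraph\<close>.\<close>

definition rainbow_sat :: "nat \<Rightarrow> nat \<Rightarrow> 'b ugraph \<Rightarrow> nat" where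
  "rainbow_sat t n H =
     (LEAST m. \<exists>(G :: nat ugraph) c.
        rainbow_saturated t H G c \<and> card (verts G) = n \<and> card (edges G) = m)"

text \<open>For complete graphs the minimum is taken over a nonempty set: a monochromatic complete
  graph is saturated, there being no edge to add.\<close>

lemma rainbow_saturated_exists:
  assumes "r \<ge> 3" and "t \<ge> 1"
  shows "\<exists>(G :: nat ugraph) c.
           rainbow_saturated t (complete_graph r) G c \<and> card (verts G) = n"
proof (intro exI conjI)
  let ?G = "complete_graph n" and ?c = "\<lambda>_ :: nat set. 1 :: nat"
  show "card (verts ?G) = n"
    by (simp add: complete_graph_def)
  have "\<not> has_rainbow_copy (complete_graph r) ?G ?c"
  proof
    assume "has_rainbow_copy (complete_graph r) ?G ?c"
    then obtain H' where iso: "isomorphic_graphs (complete_graph r) H'"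
      and inj: "inj_on ?c (edges H')"
      unfolding has_rainbow_copy_def by blast
    obtain f where f: "bij_betw f {..<r} (verts H')"
      and E: "edges H' = (\<lambda>e. f ` e) ` all_edges {..<r}"
      using iso unfolding isomorphic_graphs_def complete_graph_def ugraph.simps by (elim exE conjE)
    have "{0, 1} \<in> all_edges {..<r}" "{0, 2} \<in> all_edges {..<r}"
      using assms by (auto simp: all_edges_def)
    then have "f ` {0, 1} \<in> edges H'" "f ` {0, 2} \<in> edges H'"
      unfolding E by (simp_all only: imageI)
    with inj have eq: "f ` {0, 1} = f ` {0, 2}"
      by (rule inj_onD[OF _ refl])
    have "inj_on f {..<r}"
      using f by (rule bij_betw_imp_inj_on)
    then have "{0, 1 :: nat} = {0, 2}"
      using inj_on_image_eq_iff[of f "{..<r}" "{0, 1}" "{0, 2}", THEN iffD1, OF _ _ _ eq] assms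
      by simp
    then show False
      by (simp add: doubleton_eq_iff)
  qed
  then show "rainbow_saturated t (complete_graph r) ?G ?c"
    using assms
    by (auto simp: rainbow_saturated_def edge_coloured_graph_def simple_graph_def
        complete_graph_def)
qed

end

theory Submission
  imports Defs "HOL-Library.FuncSet" "HOL-Library.Disjoint_Sets"
begin

text \<open>
  Put \<open>d = r - 2\<close> and take the complete \<open>(d + 1)\<close>-partite graph with \<open>d\<close> parts of size \<open>k\<close> and one
  part containing all other vertices. It has at most \<open>d k n\<close> edges and no \<open>K\<^sub>r\<close> at all. Two vertices
  \<open>x\<close>, \<open>y\<close> of the same part together with the \<open>s\<close>-th vertex of each other part span a \<open>K\<^sub>r\<close> once \<open>xy\<close>
  is added; for \<open>s < k\<close> these \<open>k\<close> copies share no edge but \<open>xy\<close>. So it suffices that for every such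
  pair and every colour \<open>i\<close> one of them is rainbow and avoids \<open>i\<close>. If \<open>t\<close> is at least the number of
  edges, \<open>k = 2\<close> and an injective colouring do. Otherwise \<open>t \<le> n\<^sup>2\<close>; in a uniformly random colouring
  each copy fails with probability at most \<open>t\<close> to the power \<open>- \<alpha>\<close>, independently for different
  \<open>s\<close>, and a union bound over at most \<open>n\<^sup>4\<close> events shows that some \<open>k\<close> of order \<open>log n / log t\<close>
  works. If that \<open>k\<close> does not fit into \<open>n\<close> vertices, or if \<open>n\<close> is small, the number of all pairs of
  vertices is already below the bound.
\<close>

section \<open>Counting colourings that fail on disjoint edge sets\<close>

text \<open>Independence in counting form. A function on \<open>F\<close> is determined by its
  restrictions to the pairwise disjoint blocks \<open>E s\<close> and to the rest of
  \<open>F\<close>, so the numbers of bad restrictions multiply and each block contributes a factor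
  \<open>q\<close>. Applying \<open>B\<close> to the restriction makes the event depend on that
  block alone.\<close>

lemma card_funcset_all_blocks_le:
  fixes q :: real
  assumes fin: "finite F" "finite T" "finite S"
    and disj: "disjoint_family_on E S"
    and sub: "\<And>s. s \<in> S \<Longrightarrow> E s \<subseteq> F"
    and bad: "\<And>s. s \<in> S \<Longrightarrow> real (card {g \<in> E s \<rightarrow>\<^sub>E T. B g s}) \<le> q * real (card T) ^ card (E s)"
  shows "real (card {f \<in> F \<rightarrow>\<^sub>E T. \<forall>s\<in>S. B (restrict f (E s)) s}) \<le> q ^ card S * real (card T) ^ card F"
proof -
  define U where "U = \<Union>(E ` S)"
  define \<B> where "\<B> s = {g \<in> E s \<rightarrow>\<^sub>E T. B g s}" for s
  let ?A = "{f \<in> F \<rightarrow>\<^sub>E T. \<forall>s\<in>S. B (restrict f (E s)) s}"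
  let ?h = "\<lambda>f. (restrict f (F - U), restrict (\<lambda>s. restrict f (E s)) S)"
  have finE: "finite (E s)" if "s \<in> S" for s
    using sub[OF that] fin(1) finite_subset by blast
  have U: "U \<subseteq> F" "finite U" "card U = (\<Sum>s\<in>S. card (E s))"
    unfolding U_def using sub fin finE disj
    by (auto simp: disjoint_family_on_def intro!: card_UN_disjoint)
  have inj: "inj_on ?h ?A"
  proof (rule inj_onI)
    fix f g assume f: "f \<in> ?A" and g: "g \<in> ?A" and eq: "?h f = ?h g"
    show "f = g"
    proof
      fix x
      consider "x \<in> F - U" | s where "s \<in> S" "x \<in> E s" | "x \<notin> F"
        unfolding U_def by blast
      then show "f x = g x"
      proof cases
        case 1
        have "restrict f (F - U) x = restrict g (F - U) x"
          using eq by simp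
        then show ?thesis
          using 1 by simp
      next
        case 2
        have "restrict (\<lambda>s. restrict f (E s)) S s = restrict (\<lambda>s. restrict g (E s)) S s"
          using eq by (simp only: prod.inject)
        then have "restrict f (E s) x = restrict g (E s) x"
          using 2 by simp
        then show ?thesis
          using 2 by simp
      next
        case 3
        then show ?thesis
          using f g PiE_arb[of f F "\<lambda>_. T" x] PiE_arb[of g F "\<lambda>_. T" x] by simp
      qed
    qed
  qed
  have into: "?h ` ?A \<subseteq> ((F - U) \<rightarrow>\<^sub>E T) \<times> Pi\<^sub>E S \<B>"
  proof (rule image_subsetI)
    fix f assume f: "f \<in> ?A"
    have "restrict f (F - U) \<in> (F - U) \<rightarrow>\<^sub>E T"
      using f by auto
    moreover have "restrict f (E s) \<in> \<B> s" if "s \<in> S" for s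
      using f that sub[OF that] by (auto simp: \<B>_def)
    then have "restrict (\<lambda>s. restrict f (E s)) S \<in> Pi\<^sub>E S \<B>"
      by (simp add: restrict_PiE_iff)
    ultimately show "?h f \<in> ((F - U) \<rightarrow>\<^sub>E T) \<times> Pi\<^sub>E S \<B>"
      by (rule SigmaI)
  qed
  have fin\<B>: "finite (\<B> s)" if "s \<in> S" for s
    unfolding \<B>_def using finE[OF that] fin by (simp add: finite_PiE)
  have "card ?A \<le> card (((F - U) \<rightarrow>\<^sub>E T) \<times> Pi\<^sub>E S \<B>)"
    using inj into fin fin\<B> by (intro card_inj_on_le) (auto intro!: finite_PiE)
  also have "\<dots> = card T ^ (card F - card U) * (\<Prod>s\<in>S. card (\<B> s))"
    using fin U by (simp add: card_cartesian_product card_PiE card_Diff_subset)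
  finally have "real (card ?A) \<le> real (card T) ^ (card F - card U) * (\<Prod>s\<in>S. real (card (\<B> s)))"
    by (simp only: of_nat_le_iff of_nat_power[symmetric] of_nat_prod[symmetric] of_nat_mult[symmetric])
  also have "\<dots> \<le> real (card T) ^ (card F - card U) * (\<Prod>s\<in>S. q * real (card T) ^ card (E s))"
    using bad by (intro mult_left_mono prod_mono) (auto simp: \<B>_def)
  also have "\<dots> = real (card T) ^ (card F - card U) * (q ^ card S * real (card T) ^ card U)"
    by (simp add: prod.distrib U(3) power_sum)
  also have "\<dots> = q ^ card S * real (card T) ^ (card F - card U + card U)"
    by (simp add: power_add)
  also have "\<dots> = q ^ card S * real (card T) ^ card F"
    using card_mono[OF fin(1) U(1)] by simp
  finally show ?thesis .
qed

text \<open>The good colourings are the injections into the \<open>t - 1\<close> colours other than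
  \<open>i\<close>. Their number is the product of \<open>t - 1 - j\<close> over
  \<open>j < card E\<close>, and each factor is at least \<open>t - card E\<close>.\<close>

lemma card_not_injective_avoiding_le:
  fixes E :: "'a set"
  assumes "finite E" and "card E < t" and "i \<in> {1..t}"
  shows "real (card {g \<in> E \<rightarrow>\<^sub>E {1..t}. \<not> (inj_on g E \<and> i \<notin> g ` E)})
    \<le> (1 - (1 - real (card E) / real t) ^ card E) * real t ^ card E"
proof -
  let ?m = "card E" and ?T = "{1..t} - {i}"
  let ?good = "{g \<in> E \<rightarrow>\<^sub>E ?T. inj_on g E}"
  have T: "card ?T = t - 1"
    using assms by simp
  have "(t - ?m) ^ ?m = (\<Prod>j\<in>{0..<?m}. t - ?m)"
    by simp
  also have "\<dots> \<le> (\<Prod>j\<in>{0..<?m}. t - 1 - j)"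
    by (rule prod_mono) auto
  also have "\<dots> = card ?good"
    using card_inj_on_subset_funcset[of E ?T E] assms(1) T by simp
  finally have good: "(t - ?m) ^ ?m \<le> card ?good" .
  have "{g \<in> E \<rightarrow>\<^sub>E {1..t}. \<not> (inj_on g E \<and> i \<notin> g ` E)} = (E \<rightarrow>\<^sub>E {1..t}) - ?good"
    by (auto simp: PiE_iff extensional_def)
  also have "card \<dots> = t ^ ?m - card ?good"
  proof -
    have "?good \<subseteq> E \<rightarrow>\<^sub>E {1..t}"
      by (auto simp: PiE_iff extensional_def)
    moreover have "finite (E \<rightarrow>\<^sub>E {1..t})"
      using assms(1) by (simp add: finite_PiE)
    ultimately show ?thesis
      using assms(1) by (simp add: card_Diff_subset finite_subset card_funcsetE)
  qed
  also have "real \<dots> \<le> real t ^ ?m - real ((t - ?m) ^ ?m)"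
  proof -
    have "card ?good \<le> card (E \<rightarrow>\<^sub>E {1..t})"
      using assms by (intro card_mono finite_PiE) (auto simp: PiE_iff extensional_def)
    then show ?thesis
      using good assms(1) by (simp add: card_funcsetE of_nat_diff)
  qed
  also have "\<dots> = (1 - (1 - real ?m / real t) ^ ?m) * real t ^ ?m"
    using assms(2) by (simp add: of_nat_diff diff_divide_distrib[symmetric] field_simps flip: power_mult_distrib)
  finally show ?thesis .
qed

text \<open>For large \<open>t\<close> Bernoulli's inequality gives a bound of order \<open>1 / t\<close>, and the finitely many small
  \<open>t\<close> only require \<open>\<alpha>\<close> to be small.\<close>

lemma failure_probability_le_powr:
  fixes m :: nat
  assumes "m \<ge> 1"
  obtains \<alpha> :: real where "\<alpha> > 0"
    and "\<And>t :: nat. t > m \<Longrightarrow> 1 - (1 - real m / real t) ^ m \<le> real t powr (- \<alpha>)"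
proof
  \<comment> \<open>The fourth power makes \<open>sqrt M\<close> equal to the square of
    \<open>m\<close>, so that the Bernoulli bound is at most \<open>sqrt t / t\<close> as soon as
    \<open>t\<close> reaches \<open>M\<close>.\<close>
  define M where "M = real m ^ 4"
  \<comment> \<open>The entry \<open>1 / 2\<close> serves \<open>t\<close> from \<open>M\<close> on.
    The other entry serves \<open>t\<close> below \<open>M\<close>, where the success probability is
    at least \<open>(1 / M) ^ m\<close>. Dividing by \<open>1 + ln M\<close> instead of
    \<open>ln M\<close> stays meaningful for \<open>M = 1\<close>.\<close>
  define \<alpha> where "\<alpha> = min (1 / 2) ((1 / M) ^ m / (1 + ln M))"
  have M: "M \<ge> 1"
    using assms by (simp add: M_def)
  then have lnM: "ln M \<ge> 0"
    by simp
  show "\<alpha> > 0"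
    unfolding \<alpha>_def using M lnM by (auto intro!: divide_pos_pos add_pos_nonneg)
  fix t :: nat assume t: "t > m"
  show "1 - (1 - real m / real t) ^ m \<le> real t powr (- \<alpha>)"
  proof (cases "real t \<ge> M")
    case True
    have "1 - (1 - real m / real t) ^ m \<le> real m * (real m / real t)"
      using Bernoulli_inequality[of "- (real m / real t)" m] t by simp
    also have "\<dots> = sqrt M / real t"
    proof -
      have "sqrt M = real m * real m"
        by (rule real_sqrt_unique) (auto simp: M_def power2_eq_square power4_eq_xxxx)
      then show ?thesis
        by simp
    qed
    also have "\<dots> \<le> sqrt (real t) / real t"
      using True by (intro divide_right_mono) auto
    also have "\<dots> = real t powr (- (1 / 2))"
      using t by (simp add: powr_minus powr_half_sqrt real_sqrt_divide field_simps)
    also have "\<dots> \<le> real t powr (- \<alpha>)"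
      using t by (intro powr_mono) (auto simp: \<alpha>_def min_def)
    finally show ?thesis .
  next
    case False
    have "1 / M \<le> 1 / real t"
      using False t by (intro divide_left_mono) auto
    also have "\<dots> \<le> 1 - real m / real t"
      using t by (simp add: field_simps)
    finally have "(1 / M) ^ m \<le> (1 - real m / real t) ^ m"
      using M by (intro power_mono) auto
    moreover have "\<alpha> * ln (real t) \<le> (1 / M) ^ m"
    proof -
      have "\<alpha> * ln (real t) \<le> (1 / M) ^ m / (1 + ln M) * (1 + ln M)"
      proof (rule mult_mono)
        have "ln (real t) \<le> ln M"
          using False t by simp
        then show "ln (real t) \<le> 1 + ln M"
          by simp
      qed (use M lnM t in \<open>auto simp: \<alpha>_def\<close>)
      then show ?thesis
        using lnM by simp
    qed
    moreover have "1 + (- \<alpha> * ln (real t)) \<le> real t powr (- \<alpha>)"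
      using t exp_ge_add_one_self[of "- \<alpha> * ln (real t)"] by (simp add: powr_def)
    ultimately show ?thesis
      by simp
  qed
qed

section \<open>Rainbow copies of complete graphs as rainbow cliques, and the trivial bound\<close>

lemma image_all_edges:
  assumes "bij_betw f A B"
  shows "(\<lambda>e. f ` e) ` all_edges A = all_edges B"
proof (intro equalityI subsetI)
  fix e assume "e \<in> (\<lambda>e. f ` e) ` all_edges A"
  then obtain e' where e': "e' \<subseteq> A" "card e' = 2" "e = f ` e'"
    by (auto simp: all_edges_def)
  then have "card e = 2"
    using assms by (metis bij_betw_imp_inj_on card_image inj_on_subset)
  with e' show "e \<in> all_edges B"
    using assms by (auto simp: all_edges_def bij_betw_def)
next
  fix e assume e: "e \<in> all_edges B"
  then obtain e' where e': "e' \<subseteq> A" "e = f ` e'"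
    using assms by (auto simp: all_edges_def bij_betw_def subset_image_iff)
  then have "card e' = 2"
    using assms e by (metis (mono_tags, lifting) all_edges_def bij_betw_imp_inj_on card_image inj_on_subset mem_Collect_eq)
  with e' show "e \<in> (\<lambda>e. f ` e) ` all_edges A"
    by (auto simp: all_edges_def)
qed

lemma finite_all_edges: "finite A \<Longrightarrow> finite (all_edges A)"
  unfolding all_edges_def by simp

lemma all_edgesE:
  assumes "e \<in> all_edges A"
  obtains u v where "e = {u, v}" "u \<noteq> v" "u \<in> A" "v \<in> A"
proof -
  have "card e = 2" "e \<subseteq> A"
    using assms by (simp_all add: all_edges_def)
  then show thesis
    using that unfolding card_2_iff by blast
qed

lemma card_all_edges: "finite A \<Longrightarrow> card (all_edges A) = card A choose 2"
  unfolding all_edges_def by (rule n_subsets)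

lemma has_rainbow_copy_complete_graph_iff:
  assumes "finite (verts G)"
  shows "has_rainbow_copy (complete_graph r) G c \<longleftrightarrow>
    (\<exists>K. K \<subseteq> verts G \<and> card K = r \<and> all_edges K \<subseteq> edges G \<and> inj_on c (all_edges K))"
    (is "?L \<longleftrightarrow> ?R")
proof
  assume ?L
  then obtain H' where H': "subgraph_of H' G" "isomorphic_graphs (complete_graph r) H'" "inj_on c (edges H')"
    unfolding has_rainbow_copy_def by blast
  then obtain f where f: "bij_betw f {..<r} (verts H')" and "edges H' = (\<lambda>e. f ` e) ` all_edges {..<r}"
    unfolding isomorphic_graphs_def complete_graph_def ugraph.simps by (elim exE conjE)
  then show ?R
    using image_all_edges[OF f] bij_betw_same_card[OF f] H'(1,3)
    unfolding subgraph_of_def by (intro exI[of _ "verts H'"]) simp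
next
  assume ?R
  then obtain K where K: "K \<subseteq> verts G" "card K = r" "all_edges K \<subseteq> edges G" "inj_on c (all_edges K)"
    by blast
  have fin: "finite K"
    using K(1) assms finite_subset by blast
  then obtain f where f: "bij_betw f {..<r} K"
    using K(2) finite_same_card_bij[of "{..<r}" K] by auto
  have "isomorphic_graphs (complete_graph r) \<lparr>verts = K, edges = all_edges K\<rparr>"
    unfolding isomorphic_graphs_def complete_graph_def ugraph.simps
    using f image_all_edges[OF f] by metis
  moreover have "subgraph_of \<lparr>verts = K, edges = all_edges K\<rparr> G"
    using K fin by (simp add: subgraph_of_def simple_graph_def)
  ultimately show ?L
    unfolding has_rainbow_copy_def using K(4) by (metis ugraph.select_convs(2))
qed

lemma rainbow_sat_le:
  fixes G :: "nat ugraph"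
  assumes "rainbow_saturated t H G c"
  shows "rainbow_sat t (card (verts G)) H \<le> card (edges G)"
  unfolding rainbow_sat_def by (rule Least_le) (use assms in blast)

text \<open>The fallback for \<open>n\<close> too small for the multipartite construction.\<close>

lemma rainbow_sat_le_choose:
  assumes "r \<ge> 3" and "t \<ge> 1"
  shows "rainbow_sat t n (complete_graph r) \<le> n choose 2"
proof -
  obtain G :: "nat ugraph" and c where G: "rainbow_saturated t (complete_graph r) G c" "card (verts G) = n"
    using rainbow_saturated_exists[OF assms] by blast
  then have "finite (verts G)" "edges G \<subseteq> all_edges (verts G)"
    by (auto simp: rainbow_saturated_def edge_coloured_graph_def simple_graph_def)
  then have "card (edges G) \<le> n choose 2"
    using card_mono finite_all_edges card_all_edges G(2) by metis
  then show ?thesis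
    using rainbow_sat_le[OF G(1)] G(2) by simp
qed

section \<open>The multipartite graph and its saturation\<close>

text \<open>For \<open>j < d\<close> the vertices \<open>j * k + s\<close> with \<open>s < k\<close> form part \<open>j\<close>; all vertices from \<open>d * k\<close> on form
  part \<open>d\<close>.\<close>

definition part :: "nat \<Rightarrow> nat \<Rightarrow> nat \<Rightarrow> nat" where
  "part k d v = min (v div k) d"

definition multipartite_graph :: "nat \<Rightarrow> nat \<Rightarrow> nat \<Rightarrow> nat ugraph" where
  "multipartite_graph k d n =
     \<lparr>verts = {..<n}, edges = {{x, y} |x y. x < n \<and> y < n \<and> part k d x \<noteq> part k d y}\<rparr>"

text \<open>Since the last part starts at \<open>d * k\<close>, the formula \<open>j * k + s\<close>
  gives the \<open>s\<close>-th vertex of that part too. It must have \<open>k\<close> vertices for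
  this, hence the condition \<open>Suc d * k \<le> n\<close> below.\<close>

definition transversal :: "nat \<Rightarrow> nat \<Rightarrow> nat \<Rightarrow> nat \<Rightarrow> nat \<Rightarrow> nat set" where
  "transversal k d x y s = {x, y} \<union> (\<lambda>j. j * k + s) ` ({..d} - {part k d x})"

definition transversal_edges :: "nat \<Rightarrow> nat \<Rightarrow> nat \<Rightarrow> nat \<Rightarrow> nat \<Rightarrow> nat set set" where
  "transversal_edges k d x y s = all_edges (transversal k d x y s) - {{x, y}}"

lemma part_vertex: "s < k \<Longrightarrow> j \<le> d \<Longrightarrow> part k d (j * k + s) = j"
  by (simp add: part_def)

lemma part_le: "part k d v \<le> d"
  by (simp add: part_def)

lemma transversal_subset:
  assumes "s < k" "Suc d * k \<le> n" "x < n" "y < n"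
  shows "transversal k d x y s \<subseteq> {..<n}"
proof -
  have "j * k + s < n" if "j \<le> d" for j
  proof -
    have "j * k + s < Suc j * k"
      using assms(1) by simp
    also have "\<dots> \<le> Suc d * k"
      using that by (intro mult_le_mono1) simp
    finally show ?thesis
      using assms(2) by simp
  qed
  then show ?thesis
    using assms by (auto simp: transversal_def)
qed

lemma finite_transversal: "finite (transversal k d x y s)"
  by (simp add: transversal_def)

lemma card_transversal:
  assumes "s < k" "x \<noteq> y" "part k d x = part k d y"
  shows "card (transversal k d x y s) = d + 2"
proof -
  let ?J = "{..d} - {part k d x}"
  have "inj_on (\<lambda>j. j * k + s) ?J"
    using assms(1) by (auto intro!: inj_onI)
  then have "card ((\<lambda>j. j * k + s) ` ?J) = d"
    using part_le[of k d x] by (simp add: card_image)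
  moreover have "{x, y} \<inter> (\<lambda>j. j * k + s) ` ?J = {}"
    using assms(3) part_vertex[OF assms(1)] by (auto simp del: neq0_conv)
  ultimately show ?thesis
    unfolding transversal_def using assms(2) by (subst card_Un_disjoint) auto
qed

lemma transversal_edges_subset:
  assumes "s < k" "Suc d * k \<le> n" "x < n" "y < n" "part k d x = part k d y"
  shows "transversal_edges k d x y s \<subseteq> edges (multipartite_graph k d n)"
proof
  fix e assume e: "e \<in> transversal_edges k d x y s"
  then have "e \<in> all_edges (transversal k d x y s)" and ne: "e \<noteq> {x, y}"
    by (simp_all add: transversal_edges_def)
  then obtain u v where uv: "e = {u, v}" "u \<noteq> v"
    and in_T: "u \<in> transversal k d x y s" "v \<in> transversal k d x y s"
    by (elim all_edgesE)
  then have "u < n" "v < n"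
    using transversal_subset[OF assms(1-4)] by auto
  moreover have "part k d u \<noteq> part k d v"
    using in_T uv ne assms(5) part_vertex[OF assms(1)]
    by (auto simp: transversal_def)
  ultimately show "e \<in> edges (multipartite_graph k d n)"
    unfolding multipartite_graph_def uv(1) by auto
qed

text \<open>The index \<open>s\<close> is the residue modulo \<open>k\<close> of every selected
  vertex, so two transversals can share only \<open>x\<close> and \<open>y\<close>, and the only
  pair inside both is the one removed.\<close>

lemma disjoint_transversal_edges:
  assumes "x \<noteq> y"
  shows "disjoint_family_on (transversal_edges k d x y) {..<k}"
unfolding disjoint_family_on_def
proof (intro ballI impI)
  fix s s' assume s: "s \<in> {..<k}" "s' \<in> {..<k}" "s \<noteq> s'"
  have "transversal k d x y s \<inter> transversal k d x y s' \<subseteq> {x, y}"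
  proof -
    have "j * k + s \<noteq> j' * k + s'" for j j'
    proof
      assume "j * k + s = j' * k + s'"
      then have "(j * k + s) mod k = (j' * k + s') mod k"
        by simp
      then show False
        using s by simp
    qed
    then show ?thesis
      by (auto simp: transversal_def)
  qed
  then have "e = {x, y}" if "e \<in> all_edges (transversal k d x y s)" "e \<in> all_edges (transversal k d x y s')" for e
    using that assms card_subset_eq[of "{x, y}" e] by (auto simp: all_edges_def)
  then show "transversal_edges k d x y s \<inter> transversal_edges k d x y s' = {}"
    unfolding transversal_edges_def by blast
qed

lemma card_transversal_edges:
  assumes "s < k" "x \<noteq> y" "part k d x = part k d y"
  shows "card (transversal_edges k d x y s) = ((d + 2) choose 2) - 1"
proof -
  have "{x, y} \<in> all_edges (transversal k d x y s)"
    using assms by (auto simp: all_edges_def transversal_def)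
  then show ?thesis
    unfolding transversal_edges_def
    using card_all_edges[OF finite_transversal] card_transversal[OF assms]
    by (simp add: card_Diff_singleton)
qed

lemma simple_multipartite_graph: "simple_graph (multipartite_graph k d n)"
  by (auto simp: simple_graph_def multipartite_graph_def all_edges_def card_2_iff)

text \<open>An edge cannot have both ends in the last part, so one end is among the first
  \<open>d * k\<close> vertices.\<close>

lemma card_edges_multipartite_graph_le:
  "card (edges (multipartite_graph k d n)) \<le> d * k * n"
proof -
  have "edges (multipartite_graph k d n) \<subseteq> (\<lambda>(x, y). {x, y}) ` ({..<d * k} \<times> {..<n})"
  proof
    fix e assume "e \<in> edges (multipartite_graph k d n)"
    then obtain x y where e: "e = {x, y}" "x < n" "y < n" "part k d x \<noteq> part k d y"
      by (auto simp: multipartite_graph_def)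
    then have "x div k < d \<or> y div k < d"
      by (auto simp: part_def)
    \<comment> \<open>Division by zero yields zero, so for \<open>k = 0\<close> all vertices would
      be in part 0 and there would be no edge.\<close>
    moreover have "k > 0"
      using e(4) by (auto simp: part_def intro: gr0I)
    ultimately have "x < d * k \<or> y < d * k"
      by (simp add: div_less_iff_less_mult)
    then have "(x, y) \<in> {..<d * k} \<times> {..<n} \<or> (y, x) \<in> {..<d * k} \<times> {..<n}"
      using e(2,3) by simp
    then show "e \<in> (\<lambda>(x, y). {x, y}) ` ({..<d * k} \<times> {..<n})"
      unfolding e(1) by (metis (mono_tags, lifting) case_prod_conv image_iff insert_commute)
  qed
  then have "card (edges (multipartite_graph k d n)) \<le> card ((\<lambda>(x, y). {x, y}) ` ({..<d * k} \<times> {..<n}))"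
    by (intro card_mono) auto
  also have "\<dots> \<le> card ({..<d * k} \<times> {..<n})"
    by (rule card_image_le) simp
  finally show ?thesis
    by (simp add: card_cartesian_product)
qed

text \<open>A clique meets each of the \<open>d + 1\<close> parts at most once. Hence no colouring
  of this graph has a rainbow clique on \<open>d + 2\<close> vertices.\<close>

lemma no_large_clique_multipartite_graph:
  assumes "finite K" "all_edges K \<subseteq> edges (multipartite_graph k d n)"
  shows "card K \<le> d + 1"
proof -
  have "inj_on (part k d) K"
  proof (rule inj_onI, rule ccontr)
    fix x y assume xy: "x \<in> K" "y \<in> K" "part k d x = part k d y" "x \<noteq> y"
    then have "{x, y} \<in> edges (multipartite_graph k d n)"
      using assms(2) by (auto simp: all_edges_def)
    then show False
      using xy(3) by (auto simp: multipartite_graph_def doubleton_eq_iff)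
  qed
  then have "card K \<le> card {..d}"
    by (rule card_inj_on_le) (auto simp: part_le)
  then show ?thesis
    by simp
qed

text \<open>Every non-edge joins two vertices of one part, so the transversal supplied by
  \<open>good\<close> becomes a clique once the pair is added. It stays rainbow because its other
  edges keep their colours and avoid \<open>i\<close>.\<close>

lemma multipartite_graph_saturated:
  assumes size: "Suc d * k \<le> n"
    and col: "c ` edges (multipartite_graph k d n) \<subseteq> {1..t}"
    and good: "\<And>x y i. \<lbrakk>x < n; y < n; x \<noteq> y; part k d x = part k d y; i \<in> {1..t}\<rbrakk> \<Longrightarrow>
      \<exists>s<k. inj_on c (transversal_edges k d x y s) \<and> i \<notin> c ` transversal_edges k d x y s"
  shows "rainbow_saturated t (complete_graph (d + 2)) (multipartite_graph k d n) c"
  unfolding rainbow_saturated_def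
proof (intro conjI ballI)
  let ?G = "multipartite_graph k d n"
  have V: "verts ?G = {..<n}"
    by (simp add: multipartite_graph_def)
  show "edge_coloured_graph t ?G c"
    using col by (auto simp: edge_coloured_graph_def simple_multipartite_graph)
  show "\<not> has_rainbow_copy (complete_graph (d + 2)) ?G c"
  proof
    assume "has_rainbow_copy (complete_graph (d + 2)) ?G c"
    moreover have fin: "finite (verts ?G)"
      by (simp add: V)
    ultimately obtain K where K: "K \<subseteq> verts ?G" "card K = d + 2" "all_edges K \<subseteq> edges ?G"
      unfolding has_rainbow_copy_complete_graph_iff[OF fin] by blast
    then show False
      using no_large_clique_multipartite_graph[OF finite_subset[OF K(1) fin] K(3)] by simp
  qed
  fix e i assume e: "e \<in> all_edges (verts ?G) - edges ?G" and i: "i \<in> {1..t}"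
  then have "e \<in> all_edges {..<n}"
    by (simp add: V)
  then obtain x y where xy: "e = {x, y}" "x \<noteq> y" "x < n" "y < n"
    by (elim all_edgesE) simp
  then have part: "part k d x = part k d y"
    using e by (auto simp: multipartite_graph_def)
  obtain s where s: "s < k" "inj_on c (transversal_edges k d x y s)" "i \<notin> c ` transversal_edges k d x y s"
    using good[OF xy(3,4,2) part i] by blast
  let ?K = "transversal k d x y s" and ?E = "transversal_edges k d x y s"
  have K: "all_edges ?K = insert e ?E" "e \<notin> ?E"
    using xy by (auto simp: transversal_edges_def all_edges_def transversal_def)
  have cong: "(c(e := i)) f = c f" if "f \<in> ?E" for f
    using that K(2) by auto
  have "inj_on (c(e := i)) ?E" "(c(e := i)) ` ?E = c ` ?E"
    using s(2) cong inj_on_cong[of ?E "c(e := i)" c] by (auto simp: image_def)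
  then have inj: "inj_on (c(e := i)) (all_edges ?K)"
    unfolding K(1) using s(3) K(2) by (simp add: inj_on_insert)
  show "has_rainbow_copy (complete_graph (d + 2)) (add_edge e ?G) (c(e := i))"
  proof (subst has_rainbow_copy_complete_graph_iff)
    show "finite (verts (add_edge e ?G))"
      by (simp add: add_edge_def V)
    have "all_edges ?K \<subseteq> edges (add_edge e ?G)"
      unfolding K(1) add_edge_def using transversal_edges_subset[OF s(1) size xy(3,4) part] by auto
    then show "\<exists>K. K \<subseteq> verts (add_edge e ?G) \<and> card K = d + 2 \<and>
        all_edges K \<subseteq> edges (add_edge e ?G) \<and> inj_on (c(e := i)) (all_edges K)"
      using transversal_subset[OF s(1) size xy(3,4)] card_transversal[OF s(1) xy(2) part] inj
      by (intro exI[of _ ?K]) (simp add: add_edge_def V)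
  qed
qed

section \<open>Upper bounds from injective and from random colourings\<close>

lemma rainbow_sat_le_multipartite:
  assumes "Suc d * k \<le> n"
    and "c ` edges (multipartite_graph k d n) \<subseteq> {1..t}"
    and "\<And>x y i. \<lbrakk>x < n; y < n; x \<noteq> y; part k d x = part k d y; i \<in> {1..t}\<rbrakk> \<Longrightarrow>
      \<exists>s<k. inj_on c (transversal_edges k d x y s) \<and> i \<notin> c ` transversal_edges k d x y s"
  shows "rainbow_sat t n (complete_graph (d + 2)) \<le> d * k * n"
proof -
  have V: "card (verts (multipartite_graph k d n)) = n"
    by (simp add: multipartite_graph_def)
  have "rainbow_sat t n (complete_graph (d + 2)) \<le> card (edges (multipartite_graph k d n))"
    using rainbow_sat_le[OF multipartite_graph_saturated[OF assms]] unfolding V .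
  also have "\<dots> \<le> d * k * n"
    by (rule card_edges_multipartite_graph_le)
  finally show ?thesis .
qed

lemma finite_edges_multipartite_graph: "finite (edges (multipartite_graph k d n))"
proof -
  have "edges (multipartite_graph k d n) \<subseteq> all_edges (verts (multipartite_graph k d n))"
    "finite (verts (multipartite_graph k d n))"
    using simple_multipartite_graph[of k d n] by (simp_all add: simple_graph_def)
  then show ?thesis
    using finite_all_edges finite_subset by blast
qed

text \<open>There are enough colours to colour all edges differently. Two edge-disjoint transversals
  then use disjoint sets of colours, and \<open>i\<close> spoils at most one of them.\<close>

lemma rainbow_sat_le_many_colours:
  assumes "Suc d * 2 \<le> n" and "d * 2 * n \<le> t"
  shows "rainbow_sat t n (complete_graph (d + 2)) \<le> d * 2 * n"
proof -
  let ?F = "edges (multipartite_graph 2 d n)"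
  have "card ?F \<le> card {1..t}"
    using card_edges_multipartite_graph_le[of 2 d n] assms(2) by simp
  then have "\<exists>c. c ` ?F \<subseteq> {1..t} \<and> inj_on c ?F"
    by (rule card_le_inj[OF finite_edges_multipartite_graph finite_atLeastAtMost])
  then obtain c where c: "c ` ?F \<subseteq> {1..t}" "inj_on c ?F"
    by (elim exE conjE)
  show ?thesis
  proof (rule rainbow_sat_le_multipartite[OF assms(1) c(1)])
    fix x y i assume xy: "x < n" "y < n" "x \<noteq> y" "part 2 d x = part 2 d y"
    let ?E = "transversal_edges 2 d x y"
    have sub: "?E s \<subseteq> ?F" if "s < 2" for s
      using transversal_edges_subset[OF that assms(1) xy(1,2,4)] .
    have "?E 0 \<inter> ?E 1 = {}"
      using disjoint_transversal_edges[OF xy(3), of 2 d] by (simp add: disjoint_family_on_def)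
    then have disj: "c ` ?E 0 \<inter> c ` ?E 1 = {}"
      using inj_on_image_Int[OF c(2) sub[of 0] sub[of 1]] by (simp del: One_nat_def)
    have inj: "inj_on c (?E s)" if "s < 2" for s
      using c(2) sub[OF that] by (rule inj_on_subset)
    show "\<exists>s<2. inj_on c (?E s) \<and> i \<notin> c ` ?E s"
    proof (cases "i \<in> c ` ?E 0")
      case True
      then have "i \<notin> c ` ?E 1"
        using disj by (meson disjoint_iff)
      then show ?thesis
        using inj[of 1] by (intro exI[of _ 1]) (simp del: One_nat_def)
    next
      case False
      then show ?thesis
        using inj[of 0] by (intro exI[of _ 0]) simp
    qed
  qed
qed

text \<open>A union bound: \<open>small\<close> says that the expected number of triples
  \<open>x\<close>, \<open>y\<close>, \<open>i\<close> for which all \<open>k\<close> transversals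
  fail is below 1, so some colouring has none.\<close>

lemma rainbow_sat_le_random:
  assumes size: "Suc d * k \<le> n"
    and m: "m = ((d + 2) choose 2) - 1" "m < t"
    and q: "q = 1 - (1 - real m / real t) ^ m"
    and small: "real n ^ 2 * real t * q ^ k < 1"
  shows "rainbow_sat t n (complete_graph (d + 2)) \<le> d * k * n"
proof -
  define F where "F = edges (multipartite_graph k d n)"
  let ?T = "{1..t}" and ?E = "transversal_edges k d"
  \<comment> \<open>Ordered pairs are counted, which gives the factor \<open>real n ^ 2\<close>
    without halving.\<close>
  define P where "P = {(x, y). x < n \<and> y < n \<and> x \<noteq> y \<and> part k d x = part k d y} \<times> ?T"
  define bad where "bad x y i = {f \<in> F \<rightarrow>\<^sub>E ?T. \<forall>s\<in>{..<k}.
      \<not> (inj_on (restrict f (?E x y s)) (?E x y s) \<and> i \<notin> restrict f (?E x y s) ` ?E x y s)}" for x y i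
  define Bad where "Bad = (\<Union>((x, y), i)\<in>P. bad x y i)"
  have finF: "finite F"
    unfolding F_def by (rule finite_edges_multipartite_graph)
  have P: "P \<subseteq> ({..<n} \<times> {..<n}) \<times> ?T"
    by (auto simp: P_def)
  have finP: "finite P"
    using P by (rule finite_subset) simp
  have card_bad: "real (card (bad x y i)) \<le> q ^ k * real t ^ card F" if "((x, y), i) \<in> P" for x y i
  proof -
    have xy: "x < n" "y < n" "x \<noteq> y" "part k d x = part k d y" "i \<in> ?T"
      using that by (auto simp: P_def)
    have "real (card (bad x y i)) \<le> q ^ card {..<k} * real (card ?T) ^ card F"
      unfolding bad_def
    proof (rule card_funcset_all_blocks_le[OF finF _ _ disjoint_transversal_edges[OF xy(3)]])
      fix s assume s: "s \<in> {..<k}"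
      show sub: "?E x y s \<subseteq> F"
        unfolding F_def using transversal_edges_subset[OF _ size xy(1,2,4)] s by simp
      have card: "card (?E x y s) = m"
        using card_transversal_edges[OF _ xy(3,4)] s m(1) by simp
      show "real (card {g \<in> ?E x y s \<rightarrow>\<^sub>E ?T. \<not> (inj_on g (?E x y s) \<and> i \<notin> g ` ?E x y s)})
          \<le> q * real (card ?T) ^ card (?E x y s)"
        using card_not_injective_avoiding_le[OF finite_subset[OF sub finF] _ xy(5)] m(2)
        by (simp add: card q)
    qed auto
    then show ?thesis
      by simp
  qed
  have "q ^ k \<ge> 0"
    using m(2) by (simp add: q power_le_one)
  have "real (card Bad) \<le> (\<Sum>((x, y), i)\<in>P. real (card (bad x y i)))"
    using card_UN_le[OF finP, of "\<lambda>((x, y), i). bad x y i"]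
    by (simp add: Bad_def case_prod_unfold flip: of_nat_sum)
  also have "\<dots> \<le> (\<Sum>p\<in>P. q ^ k * real t ^ card F)"
    using card_bad by (intro sum_mono) auto
  also have "\<dots> = real (card P) * (q ^ k * real t ^ card F)"
    by simp
  also have "\<dots> \<le> (real n ^ 2 * real t) * (q ^ k * real t ^ card F)"
  proof (rule mult_right_mono)
    have "card P \<le> card (({..<n} \<times> {..<n}) \<times> ?T)"
      using P by (intro card_mono) auto
    then have "card P \<le> n * n * t"
      by (simp add: card_cartesian_product)
    then show "real (card P) \<le> real n ^ 2 * real t"
      by (metis of_nat_mono of_nat_mult power2_eq_square)
  qed (use \<open>q ^ k \<ge> 0\<close> in simp)
  also have "\<dots> = (real n ^ 2 * real t * q ^ k) * real t ^ card F"
    by simp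
  also have "\<dots> < 1 * real t ^ card F"
    using small m(2) by (intro mult_strict_right_mono) auto
  also have "\<dots> = real (card (F \<rightarrow>\<^sub>E ?T))"
    using finF by (simp add: card_funcsetE)
  finally have "card Bad < card (F \<rightarrow>\<^sub>E ?T)"
    by simp
  moreover have "finite Bad"
  proof (rule finite_subset)
    show "Bad \<subseteq> F \<rightarrow>\<^sub>E ?T"
      unfolding Bad_def bad_def by (intro UN_least) (simp only: case_prod_unfold Collect_restrict)
  qed (simp add: finite_PiE finF)
  ultimately have "\<not> F \<rightarrow>\<^sub>E ?T \<subseteq> Bad"
    using card_mono[of Bad "F \<rightarrow>\<^sub>E ?T"] by linarith
  then obtain c where c: "c \<in> F \<rightarrow>\<^sub>E ?T" "c \<notin> Bad"
    by blast
  show ?thesis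
  proof (rule rainbow_sat_le_multipartite[OF size])
    show "c ` edges (multipartite_graph k d n) \<subseteq> ?T"
      unfolding F_def[symmetric] using PiE_mem[OF c(1)] by (rule image_subsetI)
    fix x y i assume "x < n" "y < n" "x \<noteq> y" "part k d x = part k d y" "i \<in> ?T"
    then have "((x, y), i) \<in> P"
      unfolding P_def by simp
    then have "bad x y i \<subseteq> Bad"
      unfolding Bad_def using UN_upper[of "((x, y), i)" P "\<lambda>((x, y), i). bad x y i"] by simp
    then have "c \<notin> bad x y i"
      using c(2) by (rule contra_subsetD)
    then show "\<exists>s<k. inj_on c (?E x y s) \<and> i \<notin> c ` ?E x y s"
      using c(1) unfolding bad_def mem_Collect_eq inj_on_restrict_eq image_restrict_eq by blast
  qed
qed

lemma rainbow_sat_le_few_colours: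
  assumes \<alpha>: "\<alpha> > 0" "1 - (1 - real m / real t) ^ m \<le> real t powr (- \<alpha>)"
    and m: "m = ((d + 2) choose 2) - 1" "m < t"
    and d: "d \<ge> 1" and t: "t \<ge> 3" "t \<le> n ^ 2" and n: "n \<ge> 2"
  shows "real (rainbow_sat t n (complete_graph (d + 2)))
    \<le> (real d + 1) * (4 / \<alpha> + 2) * (ln (real n) / ln (real t)) * real n"
proof -
  define L where "L = ln (real n) / ln (real t)"
  \<comment> \<open>The least integer above \<open>4 / \<alpha> * L\<close>. It makes
    \<open>q ^ k\<close> smaller than \<open>1 / real n ^ 4\<close>, while
    \<open>t \<le> n ^ 2\<close> leaves at most \<open>n ^ 4\<close> events.\<close>
  define k where "k = nat \<lfloor>4 / \<alpha> * L\<rfloor> + 1"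
  define q where "q = 1 - (1 - real m / real t) ^ m"
  have lnt: "ln (real t) > 0"
    using t by simp
  have "ln (real t) \<le> ln (real n ^ 2)"
    using t n by (simp flip: of_nat_power)
  then have "ln (real t) \<le> 2 * ln (real n)"
    using n by (simp add: ln_realpow)
  then have L: "L \<ge> 1 / 2"
    using lnt by (simp add: L_def field_simps)
  have k: "real k > 4 / \<alpha> * L" "real k \<le> 4 / \<alpha> * L + 1"
  proof -
    have "4 / \<alpha> * L \<ge> 0"
      using L \<alpha>(1) by simp
    then show "real k > 4 / \<alpha> * L" "real k \<le> 4 / \<alpha> * L + 1"
      unfolding k_def by linarith+
  qed
  \<comment> \<open>The bound \<open>L \<ge> 1 / 2\<close>, a consequence of
    \<open>t \<le> n ^ 2\<close>, absorbs the rounding term 1 into \<open>2 * L\<close>.\<close>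
  have kL: "real k \<le> (4 / \<alpha> + 2) * L"
    using k(2) L by (simp add: algebra_simps)
  have bound: "real (Suc d * k) \<le> (real d + 1) * (4 / \<alpha> + 2) * L"
    using mult_left_mono[OF kL, of "real d + 1"] by (simp add: algebra_simps)
  \<comment> \<open>The factor \<open>Suc d\<close> instead of \<open>d\<close> lets one bound serve
    both cases: if the construction does not fit, \<open>n\<close> itself is below
    \<open>Suc d * k\<close>.\<close>
  have "rainbow_sat t n (complete_graph (d + 2)) \<le> Suc d * k * n"
  proof (cases "Suc d * k \<le> n")
    case True
    have "q \<ge> 0"
      using m(2) by (simp add: q_def power_le_one)
    then have "q ^ k \<le> (real t powr (- \<alpha>)) ^ k"
      using \<alpha>(2) by (intro power_mono) (auto simp: q_def)
    also have "\<dots> = exp (- (\<alpha> * real k * ln (real t)))"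
      using t by (simp add: powr_def mult_ac flip: exp_of_nat_mult)
    also have "\<dots> < exp (- (4 * ln (real n)))"
    proof -
      have "4 * L < real k * \<alpha>"
        using k(1) \<alpha>(1) by (simp add: field_simps)
      then have "4 * L * ln (real t) < real k * \<alpha> * ln (real t)"
        using lnt by (rule mult_strict_right_mono)
      then show ?thesis
        using lnt by (simp add: L_def mult_ac)
    qed
    also have "4 * ln (real n) = ln (real n ^ 4)"
      using n by (simp add: ln_realpow)
    also have "exp (- ln (real n ^ 4)) = 1 / real n ^ 4"
      using n by (simp add: exp_minus inverse_eq_divide)
    finally have qk: "q ^ k < 1 / real n ^ 4" .
    have "real n ^ 2 * real t * q ^ k \<le> real n ^ 2 * real n ^ 2 * q ^ k"
      using t(2) \<open>q \<ge> 0\<close> by (intro mult_right_mono mult_left_mono) (auto simp flip: of_nat_power)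
    also have "\<dots> = real n ^ 4 * q ^ k"
      by (simp flip: power_add)
    also have "\<dots> < 1"
      using qk n by (simp add: field_simps)
    finally have "rainbow_sat t n (complete_graph (d + 2)) \<le> d * k * n"
      by (intro rainbow_sat_le_random[OF True m q_def])
    also have "\<dots> \<le> Suc d * k * n"
      by (intro mult_le_mono1) simp
    finally show ?thesis .
  next
    case False
    have "rainbow_sat t n (complete_graph (d + 2)) \<le> n choose 2"
      using d t by (intro rainbow_sat_le_choose) auto
    also have "\<dots> \<le> n * n"
      by (simp add: choose_two div_le_dividend le_trans[OF div_le_dividend])
    also have "\<dots> \<le> Suc d * k * n"
      using False by (intro mult_le_mono1) simp
    finally show ?thesis .
  qed
  then have "real (rainbow_sat t n (complete_graph (d + 2))) \<le> real (Suc d * k) * real n"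
    by (metis of_nat_mono of_nat_mult)
  also have "\<dots> \<le> (real d + 1) * (4 / \<alpha> + 2) * L * real n"
    using bound by (rule mult_right_mono) simp
  finally show ?thesis
    unfolding L_def .
qed

theorem theorem3p13:
  fixes r :: nat
  assumes "r \<ge> 3"
  shows "\<exists>c::real. c > 0 \<and>
    (\<forall>n t :: nat. n \<ge> 1 \<longrightarrow> t \<ge> r choose 2 \<longrightarrow>
       real (rainbow_sat t n (complete_graph r))
         \<le> max (c / log 2 (real t) * real n * log 2 (real n)) (2 * (real r - 2) * real n))"
proof -
  define d where "d = r - 2"
  \<comment> \<open>The number of edges of a copy other than the added one;
    \<open>t \<ge> r choose 2\<close> amounts to \<open>m < t\<close>.\<close>
  define m where "m = (r choose 2) - 1"
  have d: "r = d + 2" "d \<ge> 1"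
    using assms by (auto simp: d_def)
  have "3 * 2 \<le> r * (r - 1)"
    using assms by (intro mult_le_mono) auto
  then have r3: "r choose 2 \<ge> 3"
    by (simp add: choose_two)
  then have "m \<ge> 1"
    by (simp add: m_def)
  then obtain \<alpha> :: real where \<alpha>: "\<alpha> > 0"
    "\<And>t :: nat. t > m \<Longrightarrow> 1 - (1 - real m / real t) ^ m \<le> real t powr (- \<alpha>)"
    using failure_probability_le_powr by blast
  define c where "c = (real d + 1) * (4 / \<alpha> + 2)"
  show ?thesis
  proof (intro exI[of _ c] conjI allI impI)
    show "c > 0"
      unfolding c_def using \<alpha>(1) by (intro mult_pos_pos add_nonneg_pos) auto
    fix n t :: nat assume n: "n \<ge> 1" and t: "t \<ge> r choose 2"
    let ?sat = "rainbow_sat t n (complete_graph r)"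
    \<comment> \<open>Up to \<open>4 * d + 1\<close> vertices, all pairs together number at most
      \<open>2 * d * n\<close>, the second term of the maximum. Beyond that, two vertices per part
      fit, and \<open>d * 2 * n \<le> n * n\<close> turns a shortage of colours into
      \<open>t \<le> n ^ 2\<close>.\<close>
    consider "n \<le> 4 * d + 1" | "n > 4 * d + 1" "d * 2 * n \<le> t" | "n > 4 * d + 1" "t < d * 2 * n"
      by linarith
    then show "real ?sat \<le> max (c / log 2 (real t) * real n * log 2 (real n)) (2 * (real r - 2) * real n)"
    proof cases
      case 1
      have "?sat \<le> n choose 2"
        using assms t r3 by (intro rainbow_sat_le_choose) auto
      also have "\<dots> \<le> (n * (4 * d)) div 2"
        unfolding choose_two using 1 by (intro div_le_mono mult_le_mono2) simp
      also have "\<dots> = 2 * d * n"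
        by simp
      finally have "real ?sat \<le> 2 * real d * real n"
        by (metis of_nat_mono of_nat_mult of_nat_numeral)
      then show ?thesis
        using d by simp
    next
      case 2
      then have "?sat \<le> d * 2 * n"
        unfolding d(1) by (intro rainbow_sat_le_many_colours) auto
      then have "real ?sat \<le> 2 * real d * real n"
        by (metis mult.commute of_nat_mono of_nat_mult of_nat_numeral)
      then show ?thesis
        using d by simp
    next
      case 3
      have "d * 2 * n \<le> n * n"
        using 3(1) by (intro mult_le_mono1) simp
      then have "t \<le> n ^ 2"
        using 3(2) unfolding power2_eq_square by linarith
      moreover have "m < t" "t \<ge> 3" "n \<ge> 2"
        using t r3 3(1) d(2) by (auto simp: m_def)
      ultimately have "real ?sat \<le> c * (ln (real n) / ln (real t)) * real n"
        unfolding c_def d(1)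
        by (intro rainbow_sat_le_few_colours[OF \<alpha>(1) \<alpha>(2)]) (use d in \<open>simp_all add: m_def\<close>)
      also have "\<dots> = c / log 2 (real t) * real n * log 2 (real n)"
        by (simp add: log_def)
      finally show ?thesis
        by simp
    qed
  qed
qed

end
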